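(* The metric space $(\mathrm{Dgm}_\infty, w_\infty)$ of persistence diagrams with the bottleneck distance does not admit a coarse embedding into a Hilbert space; that is, there is no Hilbert space $\mathcal{H}$ for which there exists a coarse embedding $(\mathrm{Dgm}_\infty, w_\infty) \to \mathcal{H}$.
   Context: Let $\mathbb{R}^2_< = \{(x,y)\in\mathbb{R}^2 : x<y\}$ with metric $d_\infty(a,b)=\|a-b\|_\infty=\max(|a_x-b_x|,|a_y-b_y|)$, and let $\Delta$ be the diagonal in $\mathbb{R}^2$; for $a\in\mathbb{R}^2_<$, $d_\infty(a,\Delta)=\inf_{t\in\Delta}\|a-t\|_\infty=(a_y-a_x)/2$. A persistence diagram is a function $D:I\to\mathbb{R}^2_<$ with $I$ a countable (possibly finite or empty) set; $\emptyset$ denotes the diagram with empty index set. A partial matching between $D_1:I_1\to\mathbb{R}^2_<$ and $D_2:I_2\to\mathbb{R}^2_<$ is a triple $(I_1',I_2',f)$ with $I_1'\subseteq I_1$, $I_2'\subseteq I_2$ and $f:I_1'\to I_2'$ a bijection. Its $\infty$-cost is $$\mathrm{cost}_\infty(f)=\max\Big\{\sup_{i\in I_1'}d_\infty(D_1(i),D_2(f(i))),\ \sup_{i\in I_1\setminus I_1'}d_\infty(D_1(i),\Delta),\ \sup_{i\in I_2\setminus I_2'}d_\infty(D_2(i),\Delta)\Big\}\in[0,\infty]$$ (suprema over empty sets are $0$). Put $\tilde w_\infty(D_1,D_2)=\inf\{\mathrm{cost}_\infty(f)\}$ over all partial matchings between $D_1$ and $D_2$. The space $(\mathrm{Dgm}_\infty,w_\infty)$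 is the set of persistence diagrams $D$ with $\tilde w_\infty(D,\emptyset)<\infty$, modulo the relation $D_1\sim D_2$ iff $\tilde w_\infty(D_1,D_2)=0$, with the induced metric $w_\infty$ (the bottleneck distance). A map $f:(X,d)\to(Y,d')$ is a coarse embedding if there exist non-decreasing functions $\rho_-,\rho_+:[0,\infty)\to[0,\infty)$ such that $\rho_-(d(x,y))\le d'(f(x),f(y))\le\rho_+(d(x,y))$ for all $x,y\in X$ and $\lim_{t\to\infty}\rho_-(t)=\infty$. A Hilbert space carries the metric induced by its norm. *)

theory Defs
  imports "HOL-Analysis.Analysis"
begin

section \<open>The half plane above the diagonal with the maximum metric\<close>

definition half_plane :: "(real \<times> real) set" where
  "half_plane = {(x, y). x < y}"

definition diagonal :: "(real \<times> real) set" where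
  "diagonal = {(x, y). x = y}"

text \<open>The library instance of \<^term>\<open>dist\<close> on pairs is the Euclidean one, hence a separate constant.\<close>

definition dinf :: "real \<times> real \<Rightarrow> real \<times> real \<Rightarrow> real" where
  "dinf a b = max \<bar>fst a - fst b\<bar> \<bar>snd a - snd b\<bar>"

definition dinf_diag :: "real \<times> real \<Rightarrow> real" where
  "dinf_diag a = (INF t\<in>diagonal. dinf a t)"

lemma dinf_nonneg [simp]: "0 \<le> dinf a b"
  by (auto simp: dinf_def)

lemma dinf_self [simp]: "dinf a a = 0"
  by (simp add: dinf_def)

lemma dinf_commute: "dinf a b = dinf b a"
  by (simp add: dinf_def abs_minus_commute)

lemma dinf_triangle: "dinf a c \<le> dinf a b + dinf b c"
  unfolding dinf_def by linarith

lemma dinf_diag_eq: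
  assumes "a \<in> half_plane"
  shows "dinf_diag a = (snd a - fst a) / 2"
  unfolding dinf_diag_def
proof (rule cInf_eq_minimum)
  let ?m = "(fst a + snd a) / 2"
  have "fst a < snd a" using assms by (auto simp: half_plane_def)
  then have 1: "\<bar>fst a - ?m\<bar> = (snd a - fst a) / 2" "\<bar>snd a - ?m\<bar> = (snd a - fst a) / 2"
    by (simp_all add: abs_if field_simps)
  have "(?m, ?m) \<in> diagonal" by (simp add: diagonal_def)
  moreover have "(snd a - fst a) / 2 = dinf a (?m, ?m)"
    unfolding dinf_def fst_conv snd_conv 1 by simp
  ultimately show "(snd a - fst a) / 2 \<in> dinf a ` diagonal"
    by (rule rev_image_eqI)
next
  fix r assume "r \<in> dinf a ` diagonal"
  then obtain t where "r = max \<bar>fst a - t\<bar> \<bar>snd a - t\<bar>"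
    by (auto simp: diagonal_def dinf_def)
  then have "\<bar>fst a - t\<bar> \<le> r" "\<bar>snd a - t\<bar> \<le> r" by simp_all
  then show "(snd a - fst a) / 2 \<le> r" by (simp add: abs_le_iff)
qed

lemma dinf_diag_triangle:
  assumes "a \<in> half_plane" "b \<in> half_plane"
  shows "dinf_diag a \<le> dinf a b + dinf_diag b"
  proof -
  have "snd a - fst a \<le> 2 * dinf a b + (snd b - fst b)"
    using abs_ge_self[of "snd a - snd b"] abs_ge_minus_self[of "fst a - fst b"]
      max.cobounded1[of "\<bar>fst a - fst b\<bar>" "\<bar>snd a - snd b\<bar>"]
      max.cobounded2[of "\<bar>snd a - snd b\<bar>" "\<bar>fst a - fst b\<bar>"]
    unfolding dinf_def by linarith
  then show ?thesis using assms by (simp add: dinf_diag_eq field_simps)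
qed

lemma dinf_diag_nonneg: "a \<in> half_plane \<Longrightarrow> 0 \<le> dinf_diag a"
  by (auto simp: dinf_diag_eq half_plane_def)


section \<open>Persistence diagrams, partial matchings and the bottleneck distance\<close>

text \<open>A family \<open>D : I \<rightarrow> \<real>\<^sup>2\<close> is a partial function whose domain is the index set \<open>I\<close>.\<close>

definition persistence_diagram :: "('i \<rightharpoonup> real \<times> real) \<Rightarrow> bool" where
  "persistence_diagram D \<longleftrightarrow> countable (dom D) \<and> ran D \<subseteq> half_plane"

definition partial_matching ::
  "('i \<rightharpoonup> real \<times> real) \<Rightarrow> ('j \<rightharpoonup> real \<times> real) \<Rightarrow> 'i set \<Rightarrow> 'j set \<Rightarrow> ('i \<Rightarrow> 'j) \<Rightarrow> bool" where
  "partial_matching D1 D2 A B f \<longleftrightarrow> A \<subseteq> dom D1 \<and> B \<subseteq> dom D2 \<and> bij_betw f A B"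

text \<open>In \<^typ>\<open>ennreal\<close> the supremum of the empty set is \<open>0\<close>.\<close>

definition matching_cost ::
  "('i \<rightharpoonup> real \<times> real) \<Rightarrow> ('j \<rightharpoonup> real \<times> real) \<Rightarrow> 'i set \<Rightarrow> 'j set \<Rightarrow> ('i \<Rightarrow> 'j) \<Rightarrow> ennreal" where
  "matching_cost D1 D2 A B f =
     Max {SUP i\<in>A. ennreal (dinf (the (D1 i)) (the (D2 (f i)))),
          SUP i\<in>dom D1 - A. ennreal (dinf_diag (the (D1 i))),
          SUP j\<in>dom D2 - B. ennreal (dinf_diag (the (D2 j)))}"

definition bottleneck ::
  "('i \<rightharpoonup> real \<times> real) \<Rightarrow> ('j \<rightharpoonup> real \<times> real) \<Rightarrow> ennreal" where
  "bottleneck D1 D2 =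
     (INF (A, B, f)\<in>{(A, B, f). partial_matching D1 D2 A B f}. matching_cost D1 D2 A B f)"

lemma matching_cost_le_iff:
  "matching_cost D1 D2 A B f \<le> c \<longleftrightarrow>
     (\<forall>i\<in>A. ennreal (dinf (the (D1 i)) (the (D2 (f i)))) \<le> c) \<and>
     (\<forall>i\<in>dom D1 - A. ennreal (dinf_diag (the (D1 i))) \<le> c) \<and>
     (\<forall>j\<in>dom D2 - B. ennreal (dinf_diag (the (D2 j))) \<le> c)"
  by (simp add: matching_cost_def SUP_le_iff)

lemma bottleneck_le:
  assumes "partial_matching D1 D2 A B f" "matching_cost D1 D2 A B f \<le> c"
  shows "bottleneck D1 D2 \<le> c"
  unfolding bottleneck_def
  by (rule INF_lower2[where i = "(A, B, f)"]) (use assms in auto)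

lemma bottleneck_greatest:
  assumes "\<And>A B f. partial_matching D1 D2 A B f \<Longrightarrow> c \<le> matching_cost D1 D2 A B f"
  shows "c \<le> bottleneck D1 D2"
  unfolding bottleneck_def by (rule INF_greatest) (use assms in auto)

lemma bottleneck_less_matching:
  assumes "bottleneck D1 D2 < c"
  obtains A B f where "partial_matching D1 D2 A B f" "matching_cost D1 D2 A B f < c"
  using assms unfolding bottleneck_def INF_less_iff by auto

lemma bottleneck_self: "bottleneck D D = 0"
proof -
  have "bottleneck D D \<le> 0"
    by (rule bottleneck_le[where A = "dom D" and B = "dom D" and f = id])
       (simp_all add: partial_matching_def matching_cost_le_iff del: le_zero_eq)
  then show ?thesis by simp
qed

lemma bottleneck_commute_le: "bottleneck D2 D1 \<le> bottleneck D1 D2"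
proof (rule bottleneck_greatest)
  fix A B f assume m: "partial_matching D1 D2 A B f"
  then have bij: "bij_betw f A B" by (simp add: partial_matching_def)
  let ?g = "inv_into A f"
  have g: "?g j \<in> A" "f (?g j) = j" if "j \<in> B" for j
    using that bij by (auto simp: bij_betw_def inv_into_into f_inv_into_f)
  have "partial_matching D2 D1 B A ?g"
    using m by (auto simp: partial_matching_def bij_betw_inv_into)
  moreover have "matching_cost D2 D1 B A ?g \<le> matching_cost D1 D2 A B f"
    using matching_cost_le_iff[of D1 D2 A B f "matching_cost D1 D2 A B f"] g
    by (subst matching_cost_le_iff, subst dinf_commute) fastforce
  ultimately show "bottleneck D2 D1 \<le> matching_cost D1 D2 A B f"
    by (rule bottleneck_le)
qed

lemma bottleneck_commute: "bottleneck D1 D2 = bottleneck D2 D1"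
  by (intro antisym bottleneck_commute_le)

lemma matching_cost_comp:
  assumes D: "ran D1 \<subseteq> half_plane" "ran D2 \<subseteq> half_plane" "ran D3 \<subseteq> half_plane"
    and f: "partial_matching D1 D2 A B f" and g: "partial_matching D2 D3 B' C g"
  shows "bottleneck D1 D3 \<le> matching_cost D1 D2 A B f + matching_cost D2 D3 B' C g"
proof -
  define cf where "cf = matching_cost D1 D2 A B f"
  define cg where "cg = matching_cost D2 D3 B' C g"
  have f1: "ennreal (dinf (the (D1 i)) (the (D2 (f i)))) \<le> cf" if "i \<in> A" for i
    using that matching_cost_le_iff[of D1 D2 A B f cf] by (simp add: cf_def)
  have f2: "ennreal (dinf_diag (the (D1 i))) \<le> cf" if "i \<in> dom D1 - A" for i
    using that matching_cost_le_iff[of D1 D2 A B f cf] by (simp add: cf_def)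
  have f3: "ennreal (dinf_diag (the (D2 i))) \<le> cf" if "i \<in> dom D2 - B" for i
    using that matching_cost_le_iff[of D1 D2 A B f cf] by (simp add: cf_def)
  have g1: "ennreal (dinf (the (D2 i)) (the (D3 (g i)))) \<le> cg" if "i \<in> B'" for i
    using that matching_cost_le_iff[of D2 D3 B' C g cg] by (simp add: cg_def)
  have g2: "ennreal (dinf_diag (the (D2 i))) \<le> cg" if "i \<in> dom D2 - B'" for i
    using that matching_cost_le_iff[of D2 D3 B' C g cg] by (simp add: cg_def)
  have g3: "ennreal (dinf_diag (the (D3 i))) \<le> cg" if "i \<in> dom D3 - C" for i
    using that matching_cost_le_iff[of D2 D3 B' C g cg] by (simp add: cg_def)
  have hp1: "the (D1 i) \<in> half_plane" if "i \<in> dom D1" for i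
    using that D by (auto simp: ran_def dom_def)
  have hp2: "the (D2 i) \<in> half_plane" if "i \<in> dom D2" for i
    using that D by (auto simp: ran_def dom_def)
  have hp3: "the (D3 i) \<in> half_plane" if "i \<in> dom D3" for i
    using that D by (auto simp: ran_def dom_def)
  have fs: "A \<subseteq> dom D1" "B \<subseteq> dom D2" "inj_on f A" "f ` A = B"
    using f by (auto simp: partial_matching_def bij_betw_def)
  have gs: "B' \<subseteq> dom D2" "C \<subseteq> dom D3" "inj_on g B'" "g ` B' = C"
    using g by (auto simp: partial_matching_def bij_betw_def)
  have add: "ennreal r \<le> c + c'"
    if "ennreal s \<le> c" "ennreal t \<le> c'" "r \<le> s + t" "0 \<le> s" "0 \<le> t" for r s t c c'
  proof -
    have "ennreal r \<le> ennreal (s + t)" using that by (intro ennreal_leI)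
    also have "\<dots> = ennreal s + ennreal t" using that by (intro ennreal_plus)
    also have "\<dots> \<le> c + c'" using that by (intro add_mono)
    finally show ?thesis .
  qed
  define A' where "A' = {i\<in>A. f i \<in> B'}"
  define h where "h = g \<circ> f"
  have "inj_on h A'"
    using fs gs by (auto simp: h_def A'_def inj_on_def)
  then have m: "partial_matching D1 D3 A' (h ` A') h"
    using fs gs by (auto simp: partial_matching_def bij_betw_def A'_def h_def)
  have c1: "ennreal (dinf (the (D1 i)) (the (D3 (h i)))) \<le> cf + cg" if "i \<in> A'" for i
    using that by (intro add[OF f1[of i] g1[of "f i"]])
      (auto simp: A'_def h_def intro: dinf_triangle)
  have c2: "ennreal (dinf_diag (the (D1 i))) \<le> cf + cg" if i: "i \<in> dom D1 - A'" for i
  proof (cases "i \<in> A")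
    case True
    then have fi: "f i \<in> dom D2 - B'" using i fs by (auto simp: A'_def)
    show ?thesis
      using True i fi hp1 hp2
      by (intro add[OF f1[of i] g2[of "f i"]]) (auto intro!: dinf_diag_triangle dinf_diag_nonneg)
  next
    case False
    then show ?thesis using f2[of i] i by (meson DiffD1 DiffI add_increasing2 zero_le)
  qed
  have c3: "ennreal (dinf_diag (the (D3 k))) \<le> cf + cg" if k: "k \<in> dom D3 - h ` A'" for k
  proof (cases "k \<in> C")
    case True
    then obtain j where j: "j \<in> B'" "g j = k" using gs by auto
    have "j \<notin> B"
    proof
      assume "j \<in> B"
      then obtain i where "i \<in> A" "f i = j" using fs by auto
      with j k show False by (auto simp: A'_def h_def)
    qed
    then have jB: "j \<in> dom D2 - B" using j gs by auto
    have "dinf_diag (the (D3 k)) \<le> dinf_diag (the (D2 j)) + dinf (the (D2 j)) (the (D3 k))"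
      using dinf_diag_triangle[OF hp3[of k] hp2[of j]] k jB by (simp add: dinf_commute)
    then show ?thesis
      using j jB hp2 by (intro add[OF f3[OF jB] g1[of j]]) (auto intro!: dinf_diag_nonneg)
  next
    case False
    then show ?thesis using g3[of k] k by (meson DiffD1 DiffI add_increasing zero_le)
  qed
  have "matching_cost D1 D3 A' (h ` A') h \<le> cf + cg"
    using c1 c2 c3 by (auto simp: matching_cost_le_iff)
  with m show ?thesis unfolding cf_def cg_def by (rule bottleneck_le)
qed

lemma bottleneck_triangle:
  assumes "persistence_diagram D1" "persistence_diagram D2" "persistence_diagram D3"
  shows "bottleneck D1 D3 \<le> bottleneck D1 D2 + bottleneck D2 D3"
proof (rule ennreal_le_epsilon)
  fix e :: real
  define u where "u = bottleneck D1 D2"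
  define v where "v = bottleneck D2 D3"
  assume "bottleneck D1 D2 + bottleneck D2 D3 < top" and e: "0 < e"
  then have fin: "u \<noteq> top" "v \<noteq> top" by (auto simp: u_def v_def)
  have "u < u + ennreal (e / 2)" "v < v + ennreal (e / 2)"
    using fin e ennreal_add_left_cancel_less[of u 0 "ennreal (e / 2)"]
      ennreal_add_left_cancel_less[of v 0 "ennreal (e / 2)"]
    by (simp_all add: less_top)
  then obtain A B f B' C g where
      f: "partial_matching D1 D2 A B f" "matching_cost D1 D2 A B f < u + ennreal (e / 2)" and
      g: "partial_matching D2 D3 B' C g" "matching_cost D2 D3 B' C g < v + ennreal (e / 2)"
    unfolding u_def v_def using bottleneck_less_matching by metis
  have "bottleneck D1 D3 \<le> matching_cost D1 D2 A B f + matching_cost D2 D3 B' C g"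
    using assms f g by (intro matching_cost_comp) (auto simp: persistence_diagram_def)
  also have "\<dots> \<le> (u + ennreal (e / 2)) + (v + ennreal (e / 2))"
    using f g by (intro add_mono) auto
  also have "\<dots> = u + v + (ennreal (e / 2) + ennreal (e / 2))" by (simp add: algebra_simps)
  also have "ennreal (e / 2) + ennreal (e / 2) = ennreal e"
    using e by (simp add: ennreal_plus[symmetric] del: ennreal_plus)
  finally show "bottleneck D1 D3 \<le> bottleneck D1 D2 + bottleneck D2 D3 + ennreal e"
    by (simp add: u_def v_def)
qed

text \<open>
  Up to bottleneck distance \<open>0\<close>, every diagram over a countable index set is a diagram
  indexed by a set of natural numbers; this is why the space below may be built from the latter.
\<close>

lemma persistence_diagram_reindex:
  fixes D :: "'i \<rightharpoonup> real \<times> real"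
  assumes "persistence_diagram D"
  shows "\<exists>D' :: nat \<rightharpoonup> real \<times> real. persistence_diagram D' \<and> bottleneck D D' = 0"
proof -
  obtain g :: "'i \<Rightarrow> nat" where g: "inj_on g (dom D)"
    using assms by (auto simp: persistence_diagram_def countable_def)
  define D' where
    "D' n = (if n \<in> g ` dom D then D (inv_into (dom D) g n) else None)" for n
  have D'g: "D' (g i) = D i" if "i \<in> dom D" for i
    using that g unfolding D'_def by (simp add: inv_into_f_f)
  have dom: "dom D' = g ` dom D"
  proof
    show "dom D' \<subseteq> g ` dom D" by (auto simp: D'_def split: if_splits)
    show "g ` dom D \<subseteq> dom D'" using D'g by (force simp: dom_def)
  qed
  have "ran D' \<subseteq> ran D"
    by (auto simp: D'_def ran_def split: if_splits)
  then have "persistence_diagram D'"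
    using assms by (auto simp: persistence_diagram_def)
  moreover have "bottleneck D D' \<le> 0"
    by (rule bottleneck_le[where A = "dom D" and B = "dom D'" and f = g])
       (use g dom D'g in \<open>simp_all add: partial_matching_def bij_betw_def matching_cost_le_iff del: le_zero_eq\<close>)
  ultimately show ?thesis by auto
qed


section \<open>The metric space of persistence diagrams\<close>

definition finite_bottleneck :: "(nat \<rightharpoonup> real \<times> real) \<Rightarrow> bool" where
  "finite_bottleneck D \<longleftrightarrow>
     persistence_diagram D \<and> bottleneck D (Map.empty :: nat \<rightharpoonup> real \<times> real) < \<infinity>"

definition diagram_equiv :: "(nat \<rightharpoonup> real \<times> real) \<Rightarrow> (nat \<rightharpoonup> real \<times> real) \<Rightarrow> bool" where
  "diagram_equiv D1 D2 \<longleftrightarrow>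
     finite_bottleneck D1 \<and> finite_bottleneck D2 \<and> bottleneck D1 D2 = 0"

lemma persistence_diagram_empty [simp]: "persistence_diagram Map.empty"
  by (simp add: persistence_diagram_def)

lemma finite_bottleneck_empty: "finite_bottleneck Map.empty"
  by (simp add: finite_bottleneck_def bottleneck_self)

lemma bottleneck_less_top:
  assumes "finite_bottleneck D1" "finite_bottleneck D2"
  shows "bottleneck D1 D2 < top"
proof -
  have "bottleneck D1 D2 \<le> bottleneck D1 (Map.empty :: nat \<rightharpoonup> _) + bottleneck (Map.empty :: nat \<rightharpoonup> _) D2"
    using assms by (intro bottleneck_triangle) (auto simp: finite_bottleneck_def)
  also have "\<dots> < top"
    using assms by (simp add: finite_bottleneck_def bottleneck_commute[of Map.empty] ennreal_add_less_top)
  finally show ?thesis .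
qed

lemma diagram_equiv_cong:
  assumes "diagram_equiv D1 D1'" "diagram_equiv D2 D2'"
  shows "bottleneck D1 D2 = bottleneck D1' D2'"
proof -
  have le: "bottleneck E1 E2 \<le> bottleneck E1' E2'"
    if "diagram_equiv E1 E1'" "diagram_equiv E2 E2'" for E1 E2 E1' E2'
  proof -
    have p: "persistence_diagram E1" "persistence_diagram E1'"
        "persistence_diagram E2" "persistence_diagram E2'"
      using that by (auto simp: diagram_equiv_def finite_bottleneck_def)
    have z: "bottleneck E1 E1' = 0" "bottleneck E2' E2 = 0"
      using that by (simp_all add: diagram_equiv_def bottleneck_commute[of E2'])
    show ?thesis
      using bottleneck_triangle[of E1 E1' E2] bottleneck_triangle[of E1' E2' E2] p z by simp
  qed
  have "diagram_equiv D1' D1" "diagram_equiv D2' D2"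
    using assms by (simp_all add: diagram_equiv_def bottleneck_commute[of D1'] bottleneck_commute[of D2'])
  with assms show ?thesis by (blast intro: antisym le)
qed

quotient_type dgm = "nat \<rightharpoonup> real \<times> real" / partial: diagram_equiv
proof (rule part_equivpI)
  show "\<exists>D. diagram_equiv D D"
    using finite_bottleneck_empty by (auto simp: diagram_equiv_def bottleneck_self)
  show "symp diagram_equiv"
    by (metis symp_def diagram_equiv_def bottleneck_commute)
  show "transp diagram_equiv"
  proof (rule transpI)
    fix D1 D2 D3 assume a: "diagram_equiv D1 D2" "diagram_equiv D2 D3"
    then have "diagram_equiv D3 D3" by (simp add: diagram_equiv_def bottleneck_self)
    then have "bottleneck D1 D3 = 0"
      using diagram_equiv_cong[of D1 D2 D3 D3] a by (simp add: diagram_equiv_def)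
    with a show "diagram_equiv D1 D3" by (simp add: diagram_equiv_def)
  qed
qed

instantiation dgm :: metric_space
begin

lift_definition dist_dgm :: "dgm \<Rightarrow> dgm \<Rightarrow> real"
  is "\<lambda>D1 D2. enn2real (bottleneck D1 D2)"
  by (simp add: diagram_equiv_cong)

definition uniformity_dgm :: "(dgm \<times> dgm) filter" where
  "uniformity_dgm = (INF e\<in>{0<..}. principal {(x, y). dist x y < e})"

definition open_dgm :: "dgm set \<Rightarrow> bool" where
  "open_dgm U \<longleftrightarrow> (\<forall>x\<in>U. \<forall>\<^sub>F (x', y) in uniformity. x' = x \<longrightarrow> y \<in> U)"

instance
proof
  fix x y z :: dgm
  show "dist x y = 0 \<longleftrightarrow> x = y"
  proof transfer
    fix D1 D2 assume "diagram_equiv D1 D1" "diagram_equiv D2 D2"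
    then have f: "finite_bottleneck D1" "finite_bottleneck D2"
      by (auto simp: diagram_equiv_def)
    with bottleneck_less_top[OF f] show "enn2real (bottleneck D1 D2) = 0 \<longleftrightarrow> diagram_equiv D1 D2"
      by (auto simp: diagram_equiv_def enn2real_eq_0_iff)
  qed
  show "dist x y \<le> dist x z + dist y z"
  proof transfer
    fix D1 D2 D3
    assume "diagram_equiv D1 D1" "diagram_equiv D2 D2" "diagram_equiv D3 D3"
    then have f: "finite_bottleneck D1" "finite_bottleneck D2" "finite_bottleneck D3"
      by (auto simp: diagram_equiv_def)
    have t: "bottleneck D1 D3 < top" "bottleneck D2 D3 < top"
      using f by (auto intro: bottleneck_less_top)
    have "bottleneck D1 D2 \<le> bottleneck D1 D3 + bottleneck D2 D3"
      using bottleneck_triangle[of D1 D3 D2] f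
      by (simp add: finite_bottleneck_def bottleneck_commute[of D3])
    then have "enn2real (bottleneck D1 D2) \<le> enn2real (bottleneck D1 D3 + bottleneck D2 D3)"
      using t by (intro enn2real_mono) (auto simp: ennreal_add_less_top)
    also have "\<dots> = enn2real (bottleneck D1 D3) + enn2real (bottleneck D2 D3)"
      using t by (rule enn2real_plus)
    finally show "enn2real (bottleneck D1 D2)
        \<le> enn2real (bottleneck D1 D3) + enn2real (bottleneck D2 D3)" .
  qed
qed (simp_all add: uniformity_dgm_def open_dgm_def)

end


section \<open>Coarse embeddings\<close>

definition coarse_embedding :: "('a::metric_space \<Rightarrow> 'b::metric_space) \<Rightarrow> bool" where
  "coarse_embedding f \<longleftrightarrow>
     (\<exists>\<rho>1 \<rho>2 :: real \<Rightarrow> real.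
        \<rho>1 \<in> {0..} \<rightarrow> {0..} \<and> \<rho>2 \<in> {0..} \<rightarrow> {0..} \<and>
        mono_on {0..} \<rho>1 \<and> mono_on {0..} \<rho>2 \<and>
        (\<forall>x y. \<rho>1 (dist x y) \<le> dist (f x) (f y) \<and> dist (f x) (f y) \<le> \<rho>2 (dist x y)) \<and>
        filterlim \<rho>1 at_top at_top)"

end

theory Submission imports Defs begin

text \<open>
  The diagrams with points \<open>(w k, w k + 2 w + v k)\<close>, \<open>k < N\<close>, realise the supremum metric on
  vectors \<open>v\<close> at scales up to \<open>w\<close>, so the space contains copies of the discrete tori
  \<open>(\<int>/4q)\<^sup>n\<close> with (a bounded distortion of) the supremum metric. Let \<open>F\<close> be the restriction of
  a coarse embedding to such a torus. Average \<open>F\<close> successively over unit steps in the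
  coordinates \<open>0, 1, 2, \<dots>\<close>. Each average \<open>h\<^sub>j\<close> stays within \<open>\<rho>\<^sub>+(1)\<close> of \<open>F\<close>, since all the
  steps together move a point by at most \<open>1\<close> in the supremum metric; hence \<open>h\<^sub>j\<close> still separates
  points that are antipodal in one coordinate. By the parallelogram law, averaging in
  coordinate \<open>j\<close> therefore lowers the mean square of the function by an amount that does not
  depend on \<open>n\<close>, while the initial mean square is bounded by \<open>\<rho>\<^sub>+(2q)\<^sup>2\<close>. This is impossible for
  large \<open>n\<close>. (It is an elementary form of the metric cotype inequality for Hilbert spaces.)
\<close>

section \<open>Successive averaging\<close>

text \<open>The mean of \<open>f\<close> over the \<open>2^j\<close> ways of applying or omitting
  each of the first \<open>j\<close> steps, arranged so that every new step is a single
  midpoint.\<close>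

fun step_avg :: "(nat \<Rightarrow> 'a \<Rightarrow> 'a) \<Rightarrow> nat \<Rightarrow> ('a \<Rightarrow> 'h::real_vector) \<Rightarrow> 'a \<Rightarrow> 'h" where
  "step_avg s 0 f x = f x"
| "step_avg s (Suc j) f x = (step_avg s j f x + step_avg s j f (s j x)) /\<^sub>R 2"

fun step_reach :: "(nat \<Rightarrow> 'a \<Rightarrow> 'a) \<Rightarrow> nat \<Rightarrow> 'a \<Rightarrow> 'a set" where
  "step_reach s 0 x = {x}"
| "step_reach s (Suc j) x = step_reach s j x \<union> step_reach s j (s j x)"

text \<open>Closed balls are convex, and \<open>step_avg\<close> is an iterated midpoint of values
  of \<open>f\<close> on \<open>step_reach\<close>.\<close>

lemma dist_step_avg_le:
  fixes f :: "'a \<Rightarrow> 'h::real_normed_vector"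
  assumes "\<And>y. y \<in> step_reach s j x \<Longrightarrow> dist c (f y) \<le> r"
  shows "dist c (step_avg s j f x) \<le> r"
  using assms
proof (induction j arbitrary: x)
  case (Suc j)
  let ?a = "step_avg s j f x" and ?b = "step_avg s j f (s j x)"
  have ab: "?a \<in> cball c r" "?b \<in> cball c r"
    using Suc by auto
  have "(1/2) *\<^sub>R ?a + (1/2) *\<^sub>R ?b \<in> cball c r"
    using ab by (intro convexD[OF convex_cball]) auto
  then show ?case by (simp add: scaleR_add_right)
qed simp

text \<open>Parallelogram law at each point; since \<open>s\<close> permutes \<open>G\<close>, the
  functions \<open>h\<close> and \<open>h o s\<close> have the same sum of squares. The inner
  product enters here.\<close>

lemma sum_norm_square_midpoint:
  fixes h :: "'a \<Rightarrow> 'h::real_inner"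
  assumes "bij_betw s G G"
  shows "(\<Sum>x\<in>G. (norm ((h x + h (s x)) /\<^sub>R 2))\<^sup>2)
    = (\<Sum>x\<in>G. (norm (h x))\<^sup>2) - (\<Sum>x\<in>G. (norm (h x - h (s x)))\<^sup>2) / 4"
proof -
  have pt: "(norm ((a + b) /\<^sub>R 2))\<^sup>2 = (norm a)\<^sup>2 / 2 + (norm b)\<^sup>2 / 2 - (norm (a - b))\<^sup>2 / 4"
    for a b :: 'h
    by (simp add: power2_norm_eq_inner inner_add_left inner_add_right inner_diff_left
        inner_diff_right inner_commute field_simps)
  have "(\<Sum>x\<in>G. (norm (h (s x)))\<^sup>2) = (\<Sum>x\<in>G. (norm (h x))\<^sup>2)"
    using sum.reindex_bij_betw[OF assms, of "\<lambda>x. (norm (h x))\<^sup>2"] .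
  then show ?thesis
    unfolding pt by (simp add: sum.distrib sum_subtractf flip: sum_divide_distrib)
qed

text \<open>Telescope along the orbit. Cauchy-Schwarz gives one factor \<open>p\<close>; the other
  counts the \<open>p\<close> steps, which contribute equally because \<open>s\<close> permutes
  \<open>G\<close>.\<close>

lemma sum_norm_square_iterate_le:
  fixes h :: "'a \<Rightarrow> 'h::real_normed_vector"
  assumes s: "bij_betw s G G"
  shows "(\<Sum>x\<in>G. (norm (h x - h ((s ^^ p) x)))\<^sup>2)
    \<le> (real p)\<^sup>2 * (\<Sum>x\<in>G. (norm (h x - h (s x)))\<^sup>2)"
proof -
  define e where "e x = norm (h x - h (s x))" for x
  have tel: "norm (h x - h ((s ^^ p) x)) \<le> (\<Sum>i<p. e ((s ^^ i) x))" for x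
  proof (induction p)
    case (Suc p)
    have "norm (h x - h ((s ^^ Suc p) x)) \<le> norm (h x - h ((s ^^ p) x)) + e ((s ^^ p) x)"
      unfolding e_def
      using norm_triangle_ineq[of "h x - h ((s ^^ p) x)" "h ((s ^^ p) x) - h (s ((s ^^ p) x))"]
      by simp
    with Suc show ?case by simp
  qed simp
  have "(\<Sum>x\<in>G. (norm (h x - h ((s ^^ p) x)))\<^sup>2) \<le> (\<Sum>x\<in>G. real p * (\<Sum>i<p. (e ((s ^^ i) x))\<^sup>2))"
  proof (rule sum_mono)
    fix x
    have "(norm (h x - h ((s ^^ p) x)))\<^sup>2 \<le> (\<Sum>i<p. e ((s ^^ i) x))\<^sup>2"
      by (intro power_mono tel) simp
    also have "\<dots> \<le> real p * (\<Sum>i<p. (e ((s ^^ i) x))\<^sup>2)"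
      using sum_squared_le_sum_of_squares[of "\<lambda>i. e ((s ^^ i) x)" "{..<p}"]
      by (simp add: mult.commute)
    finally show "(norm (h x - h ((s ^^ p) x)))\<^sup>2 \<le> real p * (\<Sum>i<p. (e ((s ^^ i) x))\<^sup>2)" .
  qed
  also have "\<dots> = real p * (\<Sum>i<p. \<Sum>x\<in>G. (e ((s ^^ i) x))\<^sup>2)"
    by (subst sum.swap) (simp add: sum_distrib_left)
  also have "\<dots> = real p * (\<Sum>i<p. \<Sum>x\<in>G. (e x)\<^sup>2)"
    using sum.reindex_bij_betw[OF bij_betw_funpow[OF s], of "\<lambda>x. (e x)\<^sup>2"] by simp
  finally show ?thesis by (simp add: e_def power2_eq_square)
qed

text \<open>Each averaging lowers the energy \<open>E\<close> by at least
  \<open>card G / (4 * p^2)\<close>, while \<open>E\<close> starts at no more than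
  \<open>card G * b^2\<close> and stays nonnegative.\<close>

lemma number_of_steps_le:
  fixes f :: "'a \<Rightarrow> 'h::real_inner"
  assumes G: "finite G" "G \<noteq> {}"
    and s: "\<And>j. j < n \<Longrightarrow> bij_betw (s j) G G"
    and near: "\<And>j x y. j < n \<Longrightarrow> x \<in> G \<Longrightarrow> y \<in> step_reach s j x \<Longrightarrow> dist (f x) (f y) \<le> r"
    and far: "\<And>j x. j < n \<Longrightarrow> x \<in> G \<Longrightarrow> 2 * r + 1 \<le> dist (f x) (f ((s j ^^ p) x))"
    and bound: "\<And>x. x \<in> G \<Longrightarrow> norm (f x) \<le> b"
  shows "real n \<le> 4 * (real p)\<^sup>2 * b\<^sup>2"
proof -
  define E where "E j = (\<Sum>x\<in>G. (norm (step_avg s j f x))\<^sup>2)" for j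
  have drop: "real (card G) \<le> 4 * (real p)\<^sup>2 * (E j - E (Suc j))" if j: "j < n" for j
  proof -
    let ?h = "step_avg s j f"
    \<comment> \<open>Of the gap \<open>2 * r + 1\<close>, passing from \<open>f\<close> to its
      average costs at most \<open>r\<close> at each end.\<close>
    have "1 \<le> (norm (?h x - ?h ((s j ^^ p) x)))\<^sup>2" if x: "x \<in> G" for x
    proof -
      let ?y = "(s j ^^ p) x"
      have y: "?y \<in> G"
        using bij_betw_funpow[OF s[OF j]] x by (auto simp: bij_betw_def)
      have "dist (f x) (?h x) \<le> r" "dist (f ?y) (?h ?y) \<le> r"
        using near[OF j] x y by (auto intro!: dist_step_avg_le)
      moreover have "dist (f x) (f ?y) \<le> dist (f x) (?h x) + dist (?h x) (?h ?y) + dist (f ?y) (?h ?y)"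
        using dist_triangle[of "f x" "f ?y" "?h x"] dist_triangle[of "?h x" "f ?y" "?h ?y"]
        by (simp add: dist_commute)
      ultimately have "1 \<le> dist (?h x) (?h ?y)"
        using far[OF j x] by simp
      then show ?thesis by (simp add: dist_norm)
    qed
    then have "real (card G) \<le> (\<Sum>x\<in>G. (norm (?h x - ?h ((s j ^^ p) x)))\<^sup>2)"
      using sum_mono[of G "\<lambda>_. 1::real"] by simp
    also have "\<dots> \<le> (real p)\<^sup>2 * (\<Sum>x\<in>G. (norm (?h x - ?h (s j x)))\<^sup>2)"
      by (rule sum_norm_square_iterate_le[OF s[OF j]])
    also have "(\<Sum>x\<in>G. (norm (?h x - ?h (s j x)))\<^sup>2) = 4 * (E j - E (Suc j))"
      unfolding E_def step_avg.simps sum_norm_square_midpoint[OF s[OF j]] by simp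
    finally show ?thesis by (simp only: mult_ac)
  qed
  have "real n * real (card G) = (\<Sum>j<n. real (card G))" by simp
  also have "\<dots> \<le> (\<Sum>j<n. 4 * (real p)\<^sup>2 * (E j - E (Suc j)))"
    by (intro sum_mono drop) simp
  also have "\<dots> = 4 * (real p)\<^sup>2 * (E 0 - E n)"
    using sum_lessThan_telescope'[of E n] by (simp flip: sum_distrib_left)
  also have "\<dots> \<le> 4 * (real p)\<^sup>2 * (real (card G) * b\<^sup>2)"
  proof (rule mult_left_mono)
    have "0 \<le> E n" by (simp add: E_def sum_nonneg)
    moreover have "E 0 \<le> (\<Sum>x\<in>G. b\<^sup>2)"
      unfolding E_def using bound by (intro sum_mono power_mono) auto
    ultimately show "E 0 - E n \<le> real (card G) * b\<^sup>2" by simp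
  qed simp
  finally have "real (card G) * real n \<le> real (card G) * (4 * (real p)\<^sup>2 * b\<^sup>2)"
    by (simp add: mult_ac)
  moreover have "0 < real (card G)" using G by (simp add: card_gt_0_iff)
  ultimately show ?thesis by (rule mult_left_le_imp_le)
qed

section \<open>Diagrams realising a supremum metric\<close>

text \<open>First coordinates are spaced by \<open>w\<close>, so changing level is expensive; for
  nonnegative \<open>v\<close> the offset \<open>2 * w\<close> keeps every point at least
  \<open>w\<close> away from the diagonal.\<close>

definition ladder :: "real \<Rightarrow> nat \<Rightarrow> (nat \<Rightarrow> real) \<Rightarrow> nat \<rightharpoonup> real \<times> real" where
  "ladder w N v k = (if k < N then Some (w * k, w * k + 2 * w + v k) else None)"

lemma dom_ladder [simp]: "dom (ladder w N v) = {..<N}"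
  by (auto simp: ladder_def dom_def)

lemma ladder_half_plane:
  assumes "0 < w" "0 \<le> v k"
  shows "(w * real k, w * real k + 2 * w + v k) \<in> half_plane"
  using assms by (simp add: half_plane_def)

lemma dinf_diag_ladder:
  assumes "0 < w" "0 \<le> v k" "k < N"
  shows "dinf_diag (the (ladder w N v k)) = w + v k / 2"
  using assms by (simp add: ladder_def dinf_diag_eq[OF ladder_half_plane])

lemma finite_bottleneck_ladder:
  assumes w: "0 < w" and v: "\<And>k. 0 \<le> v k"
  shows "finite_bottleneck (ladder w N v)"
proof -
  have "persistence_diagram (ladder w N v)"
    using ladder_half_plane[OF w v]
    by (auto simp: persistence_diagram_def ran_def ladder_def split: if_splits)
  \<comment> \<open>Every point is left unmatched; the sum is a crude common bound for all
    \<open>v k / 2\<close>.\<close>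
  moreover have "bottleneck (ladder w N v) (Map.empty :: nat \<rightharpoonup> _) \<le> ennreal (w + (\<Sum>k<N. v k))"
  proof (rule bottleneck_le[where A = "{}" and B = "{}" and f = id])
    have "w + v k / 2 \<le> w + (\<Sum>k<N. v k)" if "k < N" for k
    proof -
      have "v k \<le> (\<Sum>k<N. v k)" using v that by (intro member_le_sum) auto
      then show ?thesis using v[of k] by linarith
    qed
    then show "matching_cost (ladder w N v) Map.empty {} {} id \<le> ennreal (w + (\<Sum>k<N. v k))"
      using w v by (auto simp: matching_cost_le_iff dinf_diag_ladder simp del: ennreal_plus
          intro!: ennreal_leI)
  qed (simp add: partial_matching_def)
  ultimately show ?thesis
    by (auto simp: finite_bottleneck_def intro: le_less_trans)
qed

text \<open>Each level is matched with itself, where only the second coordinates differ.\<close>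

lemma bottleneck_ladder_le:
  assumes "\<And>k. k < N \<Longrightarrow> \<bar>v k - v' k\<bar> \<le> c"
  shows "bottleneck (ladder w N v) (ladder w N v') \<le> ennreal c"
  by (rule bottleneck_le[where A = "{..<N}" and B = "{..<N}" and f = id])
     (use assms in \<open>auto simp: partial_matching_def matching_cost_le_iff ladder_def dinf_def
        intro!: ennreal_leI\<close>)

text \<open>At a level \<open>k\<close> where \<open>v\<close> and \<open>v'\<close> differ by \<open>w\<close>, all three options cost at least \<open>w\<close>:
  leaving the point unmatched, moving it to another level, and keeping it at its level.\<close>

lemma le_bottleneck_ladder:
  assumes w: "0 < w" and v: "\<And>k. 0 \<le> v k" and k: "k < N" and far: "w \<le> \<bar>v k - v' k\<bar>"
  shows "ennreal w \<le> bottleneck (ladder w N v) (ladder w N v')"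
proof (rule bottleneck_greatest)
  fix A B and f :: "nat \<Rightarrow> nat"
  assume m: "partial_matching (ladder w N v) (ladder w N v') A B f"
  let ?c = "matching_cost (ladder w N v) (ladder w N v') A B f"
  have c: "\<And>i. i \<in> A \<Longrightarrow> ennreal (dinf (the (ladder w N v i)) (the (ladder w N v' (f i)))) \<le> ?c"
    "\<And>i. i < N \<Longrightarrow> i \<notin> A \<Longrightarrow> ennreal (dinf_diag (the (ladder w N v i))) \<le> ?c"
    using matching_cost_le_iff[of "ladder w N v" "ladder w N v'" A B f ?c] by auto
  show "ennreal w \<le> ?c"
  proof (cases "k \<in> A")
    case False
    have "ennreal w \<le> ennreal (dinf_diag (the (ladder w N v k)))"
      using k v w by (intro ennreal_leI) (simp add: dinf_diag_ladder)
    also have "\<dots> \<le> ?c" using c(2) k False by auto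
    finally show ?thesis .
  next
    case True
    then have fk: "f k < N" using m by (auto simp: partial_matching_def bij_betw_def)
    have "w \<le> dinf (the (ladder w N v k)) (the (ladder w N v' (f k)))"
    proof (cases "f k = k")
      case True
      then show ?thesis using far k by (simp add: ladder_def dinf_def)
    next
      case False
      then have "1 \<le> \<bar>real k - real (f k)\<bar>" by linarith
      then have "w * 1 \<le> w * \<bar>real k - real (f k)\<bar>" using w by (intro mult_left_mono) auto
      also have "\<dots> = \<bar>w * real k - w * real (f k)\<bar>"
        using w by (simp add: abs_mult flip: right_diff_distrib)
      finally show ?thesis using k fk by (simp add: ladder_def dinf_def)
    qed
    then have "ennreal w \<le> ennreal (dinf (the (ladder w N v k)) (the (ladder w N v' (f k))))"
      by (rule ennreal_leI)
    also have "\<dots> \<le> ?c" using c(1) True .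
    finally show ?thesis .
  qed
qed

lemma dist_abs_dgm:
  assumes "finite_bottleneck D1" "finite_bottleneck D2"
  shows "dist (abs_dgm D1) (abs_dgm D2) = enn2real (bottleneck D1 D2)"
  using assms by (simp add: dist_dgm.abs_eq diagram_equiv_def bottleneck_self)

section \<open>Discrete tori\<close>

text \<open>The distance from \<open>t\<close> to \<open>2 * q\<close> on the cycle of length
  \<open>4 * q\<close>: a tent with peak \<open>2 * q\<close> at \<open>0\<close>.\<close>

definition tri_wave :: "nat \<Rightarrow> nat \<Rightarrow> real" where
  "tri_wave q t = \<bar>real (t mod (4 * q)) - 2 * real q\<bar>"

lemma tri_wave_nonneg: "0 \<le> tri_wave q t"
  by (simp add: tri_wave_def)

lemma tri_wave_mod: "tri_wave q (t mod (4 * q) + a) = tri_wave q (t + a)"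
  by (simp add: tri_wave_def mod_add_left_eq)

lemma tri_wave_le:
  assumes "0 < q" shows "tri_wave q t \<le> 2 * real q"
proof -
  have "t mod (4 * q) < 4 * q" using assms by simp
  then show ?thesis unfolding tri_wave_def by linarith
qed

lemma tri_wave_Suc:
  assumes "0 < q" shows "\<bar>tri_wave q t - tri_wave q (Suc t)\<bar> \<le> 1"
proof (cases "Suc (t mod (4 * q)) = 4 * q")
  \<comment> \<open>At the wrap-around from \<open>4 * q - 1\<close> to \<open>0\<close> the values
    are \<open>2 * q - 1\<close> and \<open>2 * q\<close>.\<close>
  case True
  then have "real (t mod (4 * q)) = 4 * real q - 1" by linarith
  with True show ?thesis by (simp add: tri_wave_def mod_Suc)
next
  case False
  then show ?thesis by (simp add: tri_wave_def mod_Suc)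
qed

text \<open>The two absolute differences always add up to \<open>2 * q\<close>: the phase shift
  \<open>q\<close> turns the zeros of one into the maxima of the other.\<close>

lemma tri_wave_antipodal:
  assumes q: "0 < q"
  shows "real q \<le> \<bar>tri_wave q t - tri_wave q (t + 2 * q)\<bar> \<or>
    real q \<le> \<bar>tri_wave q (t + q) - tri_wave q (t + 2 * q + q)\<bar>"
proof -
  define r where "r = t mod (4 * q)"
  have r: "r < 4 * q" using q by (simp add: r_def)
  \<comment> \<open>A shift by at most one period wraps around at most once.\<close>
  have sh: "tri_wave q (t + a) = (if r + a < 4 * q then \<bar>real (r + a) - 2 * real q\<bar>
      else \<bar>real (r + a) - 6 * real q\<bar>)" if "a \<le> 4 * q" for a
  proof -
    have "(t + a) mod (4 * q) = (r + a) mod (4 * q)" by (simp add: r_def mod_add_left_eq)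
    also have "\<dots> = (if r + a < 4 * q then r + a else r + a - 4 * q)"
      using r that by (auto simp: mod_if)
    finally show ?thesis unfolding tri_wave_def by (auto simp: of_nat_diff)
  qed
  have A: "tri_wave q t = (if r < 2 * q then 2 * real q - real r else real r - 2 * real q)"
    using sh[of 0] r by auto
  have B: "tri_wave q (t + q) = (if r < q then real q - real r else
      if r < 3 * q then real r - real q else 5 * real q - real r)"
    using sh[of q] r by auto
  have C: "tri_wave q (t + 2 * q) = (if r < 2 * q then real r else 4 * real q - real r)"
    using sh[of "2 * q"] r by auto
  have shift3: "t + 2 * q + q = t + 3 * q" by simp
  have D: "tri_wave q (t + 2 * q + q) = (if r < q then real r + real q else
      if r < 3 * q then 3 * real q - real r else real r - 3 * real q)"
    unfolding shift3 using sh[of "3 * q"] r by auto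
  \<comment> \<open>Between consecutive multiples of \<open>q\<close> all four waves are linear in
    \<open>r\<close>.\<close>
  consider "r < q" | "q \<le> r" "r < 2 * q" | "2 * q \<le> r" "r < 3 * q" | "3 * q \<le> r" by linarith
  then show ?thesis
  proof cases
    case 1
    then have "tri_wave q t - tri_wave q (t + 2 * q) = 2 * real q - 2 * real r"
      "tri_wave q (t + q) - tri_wave q (t + 2 * q + q) = - 2 * real r"
      unfolding A B C D by simp_all
    then show ?thesis by linarith
  next
    case 2
    then have "tri_wave q t - tri_wave q (t + 2 * q) = 2 * real q - 2 * real r"
      "tri_wave q (t + q) - tri_wave q (t + 2 * q + q) = 2 * real r - 4 * real q"
      unfolding A B C D by simp_all
    then show ?thesis by linarith
  next
    case 3
    then have "tri_wave q t - tri_wave q (t + 2 * q) = 2 * real r - 6 * real q"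
      "tri_wave q (t + q) - tri_wave q (t + 2 * q + q) = 2 * real r - 4 * real q"
      unfolding A B C D by simp_all
    then show ?thesis by linarith
  next
    case 4
    then have "tri_wave q t - tri_wave q (t + 2 * q) = 2 * real r - 6 * real q"
      "tri_wave q (t + q) - tri_wave q (t + 2 * q + q) = 8 * real q - 2 * real r"
      unfolding A B C D by simp_all
    then show ?thesis by linarith
  qed
qed

section \<open>The torus and its unit steps\<close>

definition torus :: "nat \<Rightarrow> nat \<Rightarrow> (nat \<Rightarrow> nat) set" where
  "torus n m = {..<n} \<rightarrow>\<^sub>E {..<m}"

definition shift :: "nat \<Rightarrow> nat \<Rightarrow> (nat \<Rightarrow> nat) \<Rightarrow> nat \<Rightarrow> nat" where
  "shift m j x = x(j := Suc (x j) mod m)"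

lemma bij_betw_shift:
  assumes j: "j < n" and m: "0 < m"
  shows "bij_betw (shift m j) (torus n m) (torus n m)"
proof -
  have fin: "finite (torus n m)" unfolding torus_def by (intro finite_PiE) simp_all
  have lt: "x j < m" if "x \<in> torus n m" for x
    using PiE_mem[of x "{..<n}" "\<lambda>_. {..<m}" j] that j by (simp add: torus_def)
  have sub: "shift m j ` torus n m \<subseteq> torus n m"
  proof (rule image_subsetI)
    fix x assume "x \<in> torus n m"
    then show "shift m j x \<in> torus n m"
      using PiE_fun_upd[of "Suc (x j) mod m" "\<lambda>_. {..<m}" j x "{..<n}"] j m
      by (simp add: torus_def shift_def insert_absorb)
  qed
  have "inj_on (shift m j) (torus n m)"
  proof (rule inj_onI, rule ext)
    fix x y i
    assume x: "x \<in> torus n m" and y: "y \<in> torus n m" and eq: "shift m j x = shift m j y"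
    have "shift m j x i = shift m j y i" unfolding eq ..
    moreover have "Suc (x j) mod m = Suc (y j) mod m \<Longrightarrow> x j = y j"
      using lt[OF x] lt[OF y] by (simp add: mod_Suc split: if_splits)
    ultimately show "x i = y i" by (cases "i = j") (simp_all add: shift_def)
  qed
  with sub fin show ?thesis
    by (intro bij_betw_imageI endo_inj_surj)
qed

text \<open>Each step occurs at most once and alters only its own coordinate, so displacements never
  accumulate, however large \<open>j\<close> is.\<close>

lemma step_reach_shift:
  assumes "y \<in> step_reach (shift m) j x"
  shows "y i = x i \<or> (i < j \<and> y i = Suc (x i) mod m)"
  using assms
proof (induction j arbitrary: x)
  case (Suc j)
  consider "y \<in> step_reach (shift m) j x" | "y \<in> step_reach (shift m) j (shift m j x)"
    using Suc.prems by auto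
  then show ?case
  proof cases
    case 1
    then show ?thesis using Suc.IH[of x] by auto
  next
    \<comment> \<open>The index bound in the induction hypothesis is strict, so coordinate
      \<open>j\<close> is not moved a second time.\<close>
    case 2
    moreover have "shift m j x i = (if i = j then Suc (x j) mod m else x i)"
      by (simp add: shift_def)
    ultimately show ?thesis
      using Suc.IH[of "shift m j x"] by (cases "i = j") auto
  qed
qed simp

lemma funpow_shift:
  assumes "x j < m"
  shows "(shift m j ^^ p) x = x(j := (x j + p) mod m)"
  using assms by (induction p) (auto simp: shift_def mod_Suc_eq)

text \<open>Antipodal points have equal \<^const>\<open>tri_wave\<close> values when they lie at a quarter turn from
  the peak; hence every coordinate is recorded twice, with a phase difference of \<open>q\<close>.\<close>

definition torus_wave :: "nat \<Rightarrow> (nat \<Rightarrow> nat) \<Rightarrow> nat \<Rightarrow> real" where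
  "torus_wave q x k = tri_wave q (x (k div 2) + q * (k mod 2))"

text \<open>Each of the \<open>n\<close> coordinates occupies two levels. The spacing
  \<open>q\<close> equals the gap in \<open>tri_wave_antipodal\<close>, so the ladder detects that
  gap in full.\<close>

definition torus_dgm :: "nat \<Rightarrow> nat \<Rightarrow> (nat \<Rightarrow> nat) \<Rightarrow> dgm" where
  "torus_dgm q n x = abs_dgm (ladder (real q) (2 * n) (torus_wave q x))"

section \<open>Distances between the torus diagrams\<close>

lemma finite_bottleneck_torus:
  "0 < q \<Longrightarrow> finite_bottleneck (ladder (real q) N (torus_wave q x))"
  by (intro finite_bottleneck_ladder) (auto simp: torus_wave_def tri_wave_nonneg)

lemma dist_torus_dgm_le:
  assumes "0 < q" "0 \<le> c" "\<And>k. \<bar>torus_wave q x k - torus_wave q y k\<bar> \<le> c"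
  shows "dist (torus_dgm q n x) (torus_dgm q n y) \<le> c"
  unfolding torus_dgm_def dist_abs_dgm[OF finite_bottleneck_torus finite_bottleneck_torus, OF assms(1,1)]
  by (intro enn2real_leI bottleneck_ladder_le assms)

text \<open>The bound is independent of \<open>n\<close>, which allows \<open>n\<close> to be chosen
  last.\<close>

lemma dist_torus_dgm_diameter:
  assumes "0 < q"
  shows "dist (torus_dgm q n x) (torus_dgm q n y) \<le> 2 * real q"
proof (rule dist_torus_dgm_le)
  fix k
  show "\<bar>torus_wave q x k - torus_wave q y k\<bar> \<le> 2 * real q"
    using tri_wave_nonneg tri_wave_le[OF assms] unfolding torus_wave_def by (smt (verit))
qed (use assms in auto)

lemma dist_torus_dgm_reach:
  assumes "0 < q" "y \<in> step_reach (shift (4 * q)) j x"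
  shows "dist (torus_dgm q n x) (torus_dgm q n y) \<le> 1"
proof (rule dist_torus_dgm_le)
  fix k
  let ?i = "k div 2" and ?a = "q * (k mod 2)"
  from step_reach_shift[OF assms(2), of ?i]
  show "\<bar>torus_wave q x k - torus_wave q y k\<bar> \<le> 1"
  proof
    assume "?i < j \<and> y ?i = Suc (x ?i) mod (4 * q)"
    then show ?thesis
      using tri_wave_Suc[OF assms(1), of "x ?i + ?a"] by (simp add: torus_wave_def tri_wave_mod)
  qed (simp add: torus_wave_def)
qed (use assms in auto)

text \<open>Taking \<open>2 * q\<close> steps is half a turn in coordinate \<open>j\<close>, and one
  of its levels \<open>2 * j\<close>, \<open>2 * j + 1\<close> sees a gap of at least
  \<open>q\<close>.\<close>

lemma dist_torus_dgm_antipodal: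
  assumes q: "0 < q" and j: "j < n" and x: "x \<in> torus n (4 * q)"
  shows "real q \<le> dist (torus_dgm q n x) (torus_dgm q n ((shift (4 * q) j ^^ (2 * q)) x))"
proof -
  let ?y = "(shift (4 * q) j ^^ (2 * q)) x"
  have "x j < 4 * q" using j x by (auto simp: torus_def)
  then have y: "?y j = (x j + 2 * q) mod (4 * q)" by (simp add: funpow_shift)
  have w0: "torus_wave q z (2 * j) = tri_wave q (z j)" for z by (simp add: torus_wave_def)
  have w1: "torus_wave q z (Suc (2 * j)) = tri_wave q (z j + q)" for z
    by (simp add: torus_wave_def)
  have "\<exists>k<2 * n. real q \<le> \<bar>torus_wave q x k - torus_wave q ?y k\<bar>"
    using tri_wave_antipodal[OF q, of "x j"]
  proof
    assume "real q \<le> \<bar>tri_wave q (x j) - tri_wave q (x j + 2 * q)\<bar>"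
    then show ?thesis
      using j tri_wave_mod[of q "x j + 2 * q" 0] by (intro exI[of _ "2 * j"]) (simp add: w0 y)
  next
    assume "real q \<le> \<bar>tri_wave q (x j + q) - tri_wave q (x j + 2 * q + q)\<bar>"
    then show ?thesis
      using j by (intro exI[of _ "Suc (2 * j)"]) (simp add: w1 y tri_wave_mod)
  qed
  then obtain k where k: "k < 2 * n" "real q \<le> \<bar>torus_wave q x k - torus_wave q ?y k\<bar>"
    by blast
  let ?D = "ladder (real q) (2 * n)"
  have "ennreal (real q) \<le> bottleneck (?D (torus_wave q x)) (?D (torus_wave q ?y))"
    using q k by (intro le_bottleneck_ladder) (auto simp: torus_wave_def tri_wave_nonneg)
  then have "enn2real (ennreal (real q)) \<le> enn2real (bottleneck (?D (torus_wave q x)) (?D (torus_wave q ?y)))"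
    using bottleneck_less_top[OF finite_bottleneck_torus[OF q] finite_bottleneck_torus[OF q]]
    by (intro enn2real_mono) auto
  then show ?thesis
    using q by (simp add: torus_dgm_def dist_abs_dgm finite_bottleneck_torus)
qed

section \<open>The contradiction in high dimension\<close>

theorem theorem21:
  "\<not> (\<exists>f :: dgm \<Rightarrow> 'h::{real_inner, complete_space}. coarse_embedding f)"
proof
  assume "\<exists>f :: dgm \<Rightarrow> 'h. coarse_embedding f"
  then obtain f :: "dgm \<Rightarrow> 'h" and \<rho>1 \<rho>2 :: "real \<Rightarrow> real" where
    m1: "mono_on {0..} \<rho>1" and m2: "mono_on {0..} \<rho>2"
    and lower: "\<And>D E. \<rho>1 (dist D E) \<le> dist (f D) (f E)"
    and upper: "\<And>D E. dist (f D) (f E) \<le> \<rho>2 (dist D E)"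
    and lim: "filterlim \<rho>1 at_top at_top"
    unfolding coarse_embedding_def by blast
  have near: "dist (f D) (f E) \<le> \<rho>2 c" if "dist D E \<le> c" for D E c
    using upper[of D E] monotone_onD[OF m2, of "dist D E" c] that zero_le_dist[of D E]
    by (simp add: order_trans[OF zero_le_dist])
  have far: "\<rho>1 c \<le> dist (f D) (f E)" if "0 \<le> c" "c \<le> dist D E" for D E c
    using lower[of D E] monotone_onD[OF m1, of c "dist D E"] that by simp
  have "filterlim (\<lambda>q. \<rho>1 (real q)) at_top sequentially"
    using lim filterlim_real_sequentially by (rule filterlim_compose)
  \<comment> \<open>For such \<open>q\<close> the antipodal separation exceeds the total averaging
    error \<open>2 * \<rho>2 1\<close> by at least \<open>1\<close>.\<close>
  then have "\<forall>\<^sub>F q in sequentially. 2 * \<rho>2 1 + 1 \<le> \<rho>1 (real q) \<and> 0 < q"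
    by (auto simp: filterlim_at_top intro: eventually_conj eventually_gt_at_top)
  then obtain q where q: "0 < q" "2 * \<rho>2 1 + 1 \<le> \<rho>1 (real q)"
    by (auto dest: eventually_happens)
  define b where "b = \<rho>2 (2 * real q)"
  \<comment> \<open>The number \<open>b\<close> depends on \<open>q\<close> only, so
    \<open>n\<close> can be taken beyond the bound for half turns, \<open>p = 2 * q\<close>.\<close>
  obtain n :: nat where n: "4 * (real (2 * q))\<^sup>2 * b\<^sup>2 < real n"
    using reals_Archimedean2 by blast
  \<comment> \<open>Subtracting \<open>c\<close> turns the diameter bound into a norm bound; that
    bound holds for arbitrary arguments, so the base point may lie outside
    \<open>torus\<close>.\<close>
  define c where "c = f (torus_dgm q n (\<lambda>_. 0))"
  have "real n \<le> 4 * (real (2 * q))\<^sup>2 * b\<^sup>2"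
  proof (rule number_of_steps_le[where G = "torus n (4 * q)" and s = "shift (4 * q)"
        and f = "\<lambda>x. f (torus_dgm q n x) - c" and r = "\<rho>2 1"])
    show "finite (torus n (4 * q))" "torus n (4 * q) \<noteq> {}"
      using q by (auto simp: torus_def finite_PiE PiE_eq_empty_iff lessThan_empty_iff)
    show "bij_betw (shift (4 * q) j) (torus n (4 * q)) (torus n (4 * q))" if "j < n" for j
      using that q by (intro bij_betw_shift) auto
    show "dist (f (torus_dgm q n x) - c) (f (torus_dgm q n y) - c) \<le> \<rho>2 1"
      if "y \<in> step_reach (shift (4 * q)) j x" for j x y
      using near[OF dist_torus_dgm_reach[OF q(1) that]] by (simp add: dist_norm)
    show "2 * \<rho>2 1 + 1 \<le> dist (f (torus_dgm q n x) - c)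
        (f (torus_dgm q n ((shift (4 * q) j ^^ (2 * q)) x)) - c)"
      if "j < n" "x \<in> torus n (4 * q)" for j x
      using far[OF _ dist_torus_dgm_antipodal[OF q(1) that]] q(2) by (simp add: dist_norm)
    show "norm (f (torus_dgm q n x) - c) \<le> b" for x
      using near[OF dist_torus_dgm_diameter[OF q(1)]] by (simp add: b_def c_def dist_norm)
  qed
  with n show False by simp
qed

end
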